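(* Let $S$ be a symmetry group in dimension $d$, let $(G,p)\in\mathscr{R}_{(G,S)}$ be a framework in $\mathbb{E}^d$ with $n$ joints, and let $q$ be a configuration of $n$ points in the open upper hemisphere $\mathbb{S}^{d}_{+}$ such that $(G,q)$ has symmetry group $S^*$ and such that the projection $\pi(q)$ from the origin (the center of the sphere) onto the hyperplane $x_{d+1}=1$, then projected back to $\mathbb{E}^{d}$, is equal to $p \in \mathbb{E}^{dn}$. Then: (i) the space of $S$-symmetric infinitesimal motions of $(G,p)$ in $\mathbb{E}^{d}$ is isomorphic to the space of $S^{*}$-symmetric infinitesimal motions of $(G,q)$ in $\mathbb{S}_{+}^{d}$; (ii) the space of $S$-symmetric trivial infinitesimal motions of $(G,p)$ in $\mathbb{E}^{d}$ is isomorphic to the space of $S^{*}$-symmetric trivial infinitesimal motions of $(G,q)$ in $\mathbb{S}_{+}^{d}$; (iii) $(G,p)$ has a non-trivial $S$-symmetric infinitesimal motion in $\mathbb{E}^{d}$ if and only if $(G,q)$ has a non-trivial $S^{*}$-symmetric infinitesimal motion in $\mathbb{S}_{+}^{d}$; (iv) the space of $S$-symmetric self-stresses of $(G,p)$ in $\mathbb{E}^{d}$ is isomorphic to the space of $S^{*}$-symmetric self-stresses of $(G,q)$ in $\mathbb{S}_{+}^{d}$.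
   Context: A framework $(G,p)$ in $\mathbb{E}^d$ is a finite simple graph $G$ with vertex set $V(G)=\{1,\dots,n\}$ and edge set $E(G)$, together with an injective map $p:V(G)\to\mathbb{E}^d$; $p_i=p(i)$. An infinitesimal motion of $(G,p)$ is a map $u:V(G)\to\mathbb{E}^d$ with $(p_i-p_j)\cdot(u_i-u_j)=0$ for all $\{i,j\}\in E(G)$. It is trivial if $u_i=Ap_i+t$ for all $i$, for some skew-symmetric matrix $A$ and vector $t$; otherwise non-trivial. A self-stress is a function $\omega:E(G)\to\mathbb{R}$ with $\sum_{j:\{i,j\}\in E(G)}\omega_{ij}(p_i-p_j)=0$ for every vertex $i$. A symmetry group in dimension $d$ is a subgroup $S$ of the orthogonal group $O(\mathbb{E}^d)$. $\mathscr{R}_{(G,S)}$ is the set of frameworks $(G,p)$ in $\mathbb{E}^d$ for which there is a map $\Phi:S\to\mathrm{Aut}(G)$ with $x(p_i)=p_{\Phi(x)(i)}$ for all $i\in V(G)$, $x\in S$ (since $p$ is injective, $\Phi$ is unique and a homomorphism); write $x(i)$ for $\Phi(x)(i)$. An infinitesimal motion $u$ is $S$-symmetric if $x(u_i)=u_{x(i)}$ for all $i$ and all $x\in S$. A self-stress is $S$-symmetric if it is constant on the orbits of edges under $S$. For $x\in S$ with matrix $M_x$, $x^*$ is the orthogonal transformation of $\mathbb{E}^{d+1}$ with matrix $\begin{pmatrix}M_x&0\\0&1\end{pmatrix}$, and $S^*=\{x^*:x\in S\}$. $\mathbb{S}^d$ is the unit sphere centered at the origin in $\mathbb{E}^{d+1}$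 and $\mathbb{S}^d_+=\{a\in\mathbb{S}^d: a_{d+1}>0\}$. The condition $\pi(q)=p$ means that for each $i$ there is a scalar $\alpha_i\ne0$ (here necessarily positive) with $q_i=\alpha_i(p_i,1)$. A framework $(G,q)$ on the sphere is modelled as the cone framework $(G*o,q)$ in $\mathbb{E}^{d+1}$, where $G*o$ is $G$ with a new vertex $o$ joined to all vertices of $G$ and $o$ is placed at the origin. Thus $(G,q)$ has symmetry group $S^*$ if $(G*o,q)\in\mathscr{R}_{(G*o,S^* )}$; infinitesimal motions of $(G,q)$ on the sphere are the infinitesimal motions of $(G*o,q)$ in $\mathbb{E}^{d+1}$ with $u_o=0$ (so $u_i\cdot q_i=0$ for all $i$), trivial ones being those of the form $u_i=Aq_i$ with $A$ skew-symmetric; self-stresses of $(G,q)$ on the sphere are the self-stresses of $(G*o,q)$; such an infinitesimal motion $u$ is $S^*$-symmetric if $x^*(u_i)=u_{x^*(i)}$ for all vertices $i$ of $G*o$ and all $x^*\in S^*$, where $x^*(i)$ is the vertex of $G*o$ with $x^*(q_i)=q_{x^*(i)}$, and such a self-stress is $S^*$-symmetric if it is constant on the orbits of edges of $G*o$ under $S^*$. *)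

theory Defs
  imports "HOL-Analysis.Analysis" "HOL-Algebra.Group"
begin

text \<open>
  Euclidean \<open>d\<close>-space is \<open>real ^ 'd\<close>. The vertex set of a graph is the whole finite
  type \<open>'v\<close>, so that \<open>n = CARD('v)\<close>, and a graph is given by its set of edges. Configurations and
  infinitesimal motions are elements of the vector space \<open>real ^ 'd ^ 'v\<close>.
\<close>

section \<open>Frameworks\<close>

definition simple_graph :: "'v::finite set set \<Rightarrow> bool" where
  "simple_graph E \<longleftrightarrow> (\<forall>e\<in>E. card e = 2)"

definition graph_aut :: "'v::finite set set \<Rightarrow> ('v \<Rightarrow> 'v) set" where
  "graph_aut E = {\<phi>. bij \<phi> \<and> (\<forall>i j. {i, j} \<in> E \<longleftrightarrow> {\<phi> i, \<phi> j} \<in> E)}"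

definition framework :: "'v::finite set set \<Rightarrow> real ^ 'd ^ 'v \<Rightarrow> bool" where
  "framework E p \<longleftrightarrow> simple_graph E \<and> inj (\<lambda>i. p $ i)"

definition skew_symmetric :: "real ^ 'd ^ 'd \<Rightarrow> bool" where
  "skew_symmetric A \<longleftrightarrow> transpose A = - A"

definition inf_motions :: "'v::finite set set \<Rightarrow> real ^ 'd ^ 'v \<Rightarrow> (real ^ 'd ^ 'v) set" where
  "inf_motions E p = {u. \<forall>i j. {i, j} \<in> E \<longrightarrow> (p $ i - p $ j) \<bullet> (u $ i - u $ j) = 0}"

definition trivial_motions :: "'v::finite set set \<Rightarrow> real ^ 'd ^ 'v \<Rightarrow> (real ^ 'd ^ 'v) set" where
  "trivial_motions E p =
     {u \<in> inf_motions E p. \<exists>A t. skew_symmetric A \<and> (\<forall>i. u $ i = A *v (p $ i) + t)}"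

text \<open>
  A function on the edge set is a vector indexed by all vertex sets that vanishes off the edge set;
  this makes the self-stresses a subspace of \<open>real ^ 'v set\<close>.
\<close>

definition self_stresses :: "'v::finite set set \<Rightarrow> real ^ 'd ^ 'v \<Rightarrow> (real ^ 'v set) set" where
  "self_stresses E p =
     {\<omega>. (\<forall>e. e \<notin> E \<longrightarrow> \<omega> $ e = 0) \<and>
         (\<forall>i. (\<Sum>j\<in>{j. {i, j} \<in> E}. (\<omega> $ {i, j}) *\<^sub>R (p $ i - p $ j)) = 0)}"

section \<open>Symmetry\<close>

definition orthogonal_group :: "(real ^ 'd \<Rightarrow> real ^ 'd) monoid" where
  "orthogonal_group =
     \<lparr>carrier = {f. orthogonal_transformation f}, monoid.mult = (\<circ>), one = id\<rparr>"

definition symmetry_group :: "(real ^ 'd \<Rightarrow> real ^ 'd) set \<Rightarrow> bool" where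
  "symmetry_group S \<longleftrightarrow> subgroup S orthogonal_group"

definition symmetric_frameworks ::
    "'v::finite set set \<Rightarrow> (real ^ 'd \<Rightarrow> real ^ 'd) set \<Rightarrow> (real ^ 'd ^ 'v) set" where
  "symmetric_frameworks E S =
     {p. framework E p \<and>
         (\<exists>\<Phi>. \<forall>x\<in>S. \<Phi> x \<in> graph_aut E \<and> (\<forall>i. x (p $ i) = p $ (\<Phi> x i)))}"

text \<open>
  The vertex \<open>x(i)\<close>. For \<open>p \<in> symmetric_frameworks E S\<close> and \<open>x \<in> S\<close> it is well defined and equal to
  \<open>\<Phi> x i\<close>, see \<open>vertex_action_eq\<close> below.
\<close>

definition vertex_action :: "real ^ 'd ^ 'v \<Rightarrow> (real ^ 'd \<Rightarrow> real ^ 'd) \<Rightarrow> 'v \<Rightarrow> 'v" where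
  "vertex_action p x i = (THE j. x (p $ i) = p $ j)"

definition symmetric_motions ::
    "(real ^ 'd \<Rightarrow> real ^ 'd) set \<Rightarrow> real ^ 'd ^ 'v \<Rightarrow> (real ^ 'd ^ 'v) set" where
  "symmetric_motions S p = {u. \<forall>x\<in>S. \<forall>i. x (u $ i) = u $ vertex_action p x i}"

definition edge_orbit ::
    "(real ^ 'd \<Rightarrow> real ^ 'd) set \<Rightarrow> real ^ 'd ^ 'v \<Rightarrow> 'v set \<Rightarrow> 'v set set" where
  "edge_orbit S p e = (\<lambda>x. vertex_action p x ` e) ` S"

definition symmetric_stresses ::
    "'v set set \<Rightarrow> (real ^ 'd \<Rightarrow> real ^ 'd) set \<Rightarrow> real ^ 'd ^ 'v \<Rightarrow> (real ^ 'v set) set" where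
  "symmetric_stresses E S p = {\<omega>. \<forall>e\<in>E. (\<lambda>f. \<omega> $ f) constant_on edge_orbit S p e}"

section \<open>The sphere\<close>

text \<open>
  Euclidean \<open>(d+1)\<close>-space is \<open>real ^ 'd option\<close>; the last coordinate has index \<open>None\<close>.
\<close>

definition homogenize :: "real ^ 'd \<Rightarrow> real ^ 'd option" where
  "homogenize a = (\<chi> k. case k of None \<Rightarrow> 1 | Some l \<Rightarrow> a $ l)"

definition upper_hemisphere :: "(real ^ ('d::finite) option) set" where
  "upper_hemisphere = {a \<in> sphere 0 1. a $ None > 0}"

definition projects_to :: "real ^ 'd option ^ 'v \<Rightarrow> real ^ 'd ^ 'v \<Rightarrow> bool" where
  "projects_to q p \<longleftrightarrow> (\<forall>i. \<exists>\<alpha>. \<alpha> \<noteq> 0 \<and> q $ i = \<alpha> *\<^sub>R homogenize (p $ i))"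

definition star_matrix :: "real ^ 'd ^ 'd \<Rightarrow> real ^ 'd option ^ 'd option" where
  "star_matrix M = (\<chi> k l. case (k, l) of
       (Some a, Some b) \<Rightarrow> M $ a $ b
     | (None, None) \<Rightarrow> 1
     | _ \<Rightarrow> 0)"

definition star :: "(real ^ 'd \<Rightarrow> real ^ 'd) \<Rightarrow> real ^ 'd option \<Rightarrow> real ^ 'd option" where
  "star x = (\<lambda>a. star_matrix (matrix x) *v a)"

text \<open>The cone \<open>G * o\<close> has vertex type \<open>'v option\<close>, with cone vertex \<open>o = None\<close>.\<close>

definition cone_graph :: "'v::finite set set \<Rightarrow> 'v option set set" where
  "cone_graph E = (\<lambda>e. Some ` e) ` E \<union> {{None, Some i} |i. True}"

definition cone_conf :: "real ^ 'd ^ 'v \<Rightarrow> real ^ 'd ^ 'v option" where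
  "cone_conf q = (\<chi> i. case i of None \<Rightarrow> 0 | Some j \<Rightarrow> q $ j)"

definition sphere_motions ::
    "'v::finite set set \<Rightarrow> real ^ 'd ^ 'v \<Rightarrow> (real ^ 'd ^ 'v option) set" where
  "sphere_motions E q = {u \<in> inf_motions (cone_graph E) (cone_conf q). u $ None = 0}"

definition sphere_trivial_motions ::
    "'v::finite set set \<Rightarrow> real ^ 'd ^ 'v \<Rightarrow> (real ^ 'd ^ 'v option) set" where
  "sphere_trivial_motions E q =
     {u \<in> sphere_motions E q. \<exists>A. skew_symmetric A \<and> (\<forall>i. u $ Some i = A *v (q $ i))}"

section \<open>Isomorphic subspaces\<close>

text \<open>
  A linear map on a subspace extends to the whole space, so it is no restriction that the
  isomorphism is given by a linear map on the ambient space.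
\<close>

definition isomorphic_subspaces :: "'a::real_vector set \<Rightarrow> 'b::real_vector set \<Rightarrow> bool" where
  "isomorphic_subspaces U W \<longleftrightarrow>
     subspace U \<and> subspace W \<and> (\<exists>f. linear f \<and> bij_betw f U W)"

section \<open>Consistency of the definitions\<close>

lemma group_orthogonal_group: "group (orthogonal_group :: (real ^ 'd \<Rightarrow> real ^ 'd) monoid)"
proof (rule groupI)
  fix f :: "real ^ 'd \<Rightarrow> real ^ 'd"
  assume "f \<in> carrier orthogonal_group"
  then have f: "orthogonal_transformation f"
    by (simp add: orthogonal_group_def)
  have "orthogonal_transformation (inv_into UNIV f)"
    using f by (rule orthogonal_transformation_inv)
  moreover have "inv_into UNIV f \<circ> f = id"
    using orthogonal_transformation_inj[OF f] by simp
  ultimately show "\<exists>g\<in>carrier orthogonal_group. g \<otimes>\<^bsub>orthogonal_group\<^esub> f = \<one>\<^bsub>orthogonal_group\<^esub>"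
    by (auto simp: orthogonal_group_def)
qed (auto simp: orthogonal_group_def orthogonal_transformation_compose o_assoc
       orthogonal_transformation_def linear_id linear_compose)

lemma vertex_action_eq:
  assumes "inj (\<lambda>i. p $ i)" and "x (p $ i) = p $ j"
  shows "vertex_action p x i = j"
  using assms by (auto simp: vertex_action_def dest: injD)

lemma star_homogenize:
  assumes "linear x"
  shows "star x (homogenize a) = homogenize (x a)"
proof -
  have "x a = matrix x *v a"
    using assms by (simp add: matrix_works)
  then show ?thesis
    by (auto simp: star_def star_matrix_def homogenize_def vec_eq_iff matrix_vector_mult_def
          UNIV_option_conv sum.reindex split: option.split)
qed

end

theory Submission
  imports Defs
begin

text \<open>
  Write \<open>P i = (p i, 1)\<close> and \<open>h i = norm (P i)\<close>. A point of the open upper hemisphere that projects to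
  \<open>p i\<close> must be \<open>q i = P i / h i\<close>. An orthogonal transformation preserves norms, so \<open>h\<close> is constant on
  the orbits of the vertices; hence \<open>star x\<close> maps \<open>q i\<close> to \<open>q (x i)\<close>, and it permutes the vertices of
  the cone as \<open>x\<close> permutes those of the graph, with the cone vertex fixed.

  A motion \<open>u\<close> of \<open>p\<close> corresponds to the motion \<open>v i = (u i, - (u i \<bullet> p i)) / h i\<close> of \<open>q\<close>. The last
  coordinate is the one that makes \<open>v i\<close> orthogonal to \<open>q i\<close>, and for such \<open>v\<close> the edge condition on the
  sphere reads \<open>q i \<bullet> v j + q j \<bullet> v i = 0\<close>, where the left-hand side is
  \<open>(p i - p j) \<bullet> (u i - u j)\<close> divided by \<open>- (h i * h j)\<close>. The motion \<open>A p + t\<close> corresponds to \<open>B q\<close>, where \<open>B\<close> is the skew-symmetric matrix with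
  blocks \<open>A\<close>, \<open>t\<close>, \<open>- t\<close> and \<open>0\<close>, and every skew-symmetric matrix in one more dimension has this form.

  A stress \<open>\<omega>\<close> of \<open>p\<close> corresponds to the stress of the cone with the value \<open>\<omega> i j * h i * h j\<close> at an
  edge of the graph and \<open>h i * (\<Sum>j. \<omega> i j * (h i - h j))\<close> at the edge from \<open>o\<close> to \<open>i\<close>. Its resultant
  at the vertex \<open>i\<close> is \<open>h i\<close> times the resultant of \<open>\<omega>\<close> at \<open>i\<close>, with last coordinate \<open>0\<close>
  (\<open>lift_stress_equilibrium\<close>). Conversely, the last coordinate of the equilibrium at \<open>i\<close> determines the
  stress on the cone edges, so every stress of the cone arises in this way.

  Both correspondences are injective linear maps on the ambient spaces. They preserve and reflect being
  a motion, a trivial motion or a stress and, because \<open>h\<close> is invariant under the symmetries, also the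
  symmetry of a motion or of a stress. All four claims follow.
\<close>

section \<open>Linear algebra in one more dimension\<close>

text \<open>The vector \<open>(a, c)\<close>, whose last coordinate, of index \<open>None\<close>, is \<open>c\<close>.\<close>

definition append_coord :: "real ^ 'd \<Rightarrow> real \<Rightarrow> real ^ 'd option" where
  "append_coord a c = (\<chi> k. case k of None \<Rightarrow> c | Some l \<Rightarrow> a $ l)"

lemma append_coord_nth [simp]:
  "append_coord a c $ None = c" "append_coord a c $ Some l = a $ l"
  by (simp_all add: append_coord_def)

lemma append_coord_eq_iff [simp]: "append_coord a c = append_coord b e \<longleftrightarrow> a = b \<and> c = e"
  by (auto simp: vec_eq_iff append_coord_def split: option.splits)

lemma append_coord_cases: obtains b c where "a = append_coord b c"
proof
  show "a = append_coord (\<chi> l. a $ Some l) (a $ None)"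
    by (auto simp: vec_eq_iff append_coord_def split: option.splits)
qed

lemma sum_UNIV_option:
  fixes f :: "'b::finite option \<Rightarrow> 'a::comm_monoid_add"
  shows "sum f UNIV = f None + (\<Sum>l\<in>UNIV. f (Some l))"
  by (simp add: UNIV_option_conv sum.reindex)

lemma inner_append_coord [simp]: "append_coord a c \<bullet> append_coord b e = a \<bullet> b + c * e"
  by (simp add: inner_vec_def sum_UNIV_option)

lemma append_coord_algebra:
  "append_coord a c + append_coord b e = append_coord (a + b) (c + e)"
  "append_coord a c - append_coord b e = append_coord (a - b) (c - e)"
  "r *\<^sub>R append_coord a c = append_coord (r *\<^sub>R a) (r * c)"
  "0 = append_coord 0 0"
  by (auto simp: vec_eq_iff append_coord_def split: option.splits)

lemma append_coord_eq_0_iff: "append_coord a c = 0 \<longleftrightarrow> a = 0 \<and> c = 0"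
  by (simp add: append_coord_algebra(4))

lemma sum_append_coord:
  "(\<Sum>i\<in>I. append_coord (f i) (g i)) = append_coord (\<Sum>i\<in>I. f i) (\<Sum>i\<in>I. g i)"
  by (induction I rule: infinite_finite_induct) (simp_all add: append_coord_algebra)

lemma homogenize_eq: "homogenize a = append_coord a 1"
  by (simp add: homogenize_def append_coord_def)

lemma star_append_coord:
  assumes "linear x"
  shows "star x (append_coord a c) = append_coord (x a) c"
proof -
  have "x a = matrix x *v a"
    using assms by (simp add: matrix_works)
  then show ?thesis
    by (auto simp: star_def star_matrix_def append_coord_def vec_eq_iff matrix_vector_mult_def
          sum_UNIV_option split: option.split)
qed

lemma star_zero [simp]: "star x 0 = 0"
  by (simp add: star_def)

text \<open>
  The matrix with blocks \<open>A\<close>, \<open>t\<close>, \<open>- t\<close> (as a row) and \<open>0\<close>; on \<open>(a, 1)\<close> its first \<open>d\<close> coordinates are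
  the infinitesimal isometry \<open>A a + t\<close>.
\<close>

definition skew_extension :: "real ^ 'd ^ 'd \<Rightarrow> real ^ 'd \<Rightarrow> real ^ 'd option ^ 'd option" where
  "skew_extension A t = (\<chi> k l. case (k, l) of
       (Some a, Some b) \<Rightarrow> A $ a $ b
     | (Some a, None) \<Rightarrow> t $ a
     | (None, Some b) \<Rightarrow> - t $ b
     | (None, None) \<Rightarrow> 0)"

lemma skew_extension_mult:
  "skew_extension A t *v append_coord a c = append_coord (A *v a + c *\<^sub>R t) (- (t \<bullet> a))"
  by (auto simp: skew_extension_def append_coord_def vec_eq_iff matrix_vector_mult_def
      sum_UNIV_option inner_vec_def sum_negf split: option.split)

lemma skew_symmetric_iff: "skew_symmetric A \<longleftrightarrow> (\<forall>k l. A $ k $ l + A $ l $ k = 0)"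
  by (simp add: skew_symmetric_def vec_eq_iff transpose_def eq_neg_iff_add_eq_0) (metis add.commute)

lemma skew_symmetric_extension:
  assumes "skew_symmetric A"
  shows "skew_symmetric (skew_extension A t)"
  using assms by (simp add: skew_symmetric_iff split_option_all skew_extension_def)

lemma skew_symmetric_extensionE:
  fixes B :: "real ^ ('d::finite) option ^ 'd option"
  assumes "skew_symmetric B"
  obtains A t where "skew_symmetric A" "B = skew_extension A t"
proof
  have B: "B $ k $ l + B $ l $ k = 0" for k l
    using assms by (simp add: skew_symmetric_iff)
  let ?A = "\<chi> a b. B $ Some a $ Some b"
  show "skew_symmetric ?A"
    using B by (simp add: skew_symmetric_iff)
  show "B = skew_extension ?A (\<chi> a. B $ Some a $ None)"
  proof (intro vec_eq_iff[THEN iffD2] allI)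
    fix k l
    show "B $ k $ l = skew_extension ?A (\<chi> a. B $ Some a $ None) $ k $ l"
      using B[of k l] by (cases k; cases l) (simp_all add: skew_extension_def)
  qed
qed

lemma skew_symmetric_inner_self:
  assumes "skew_symmetric A"
  shows "(A *v a) \<bullet> a = 0"
proof -
  have "(- A) *v a = - (A *v a)"
    by (simp add: vec_eq_iff matrix_vector_mult_def sum_negf)
  then have "transpose A *v a = - (A *v a)"
    using assms by (simp only: skew_symmetric_def)
  then have "(A *v a) \<bullet> a = - (A *v a) \<bullet> a"
    by (metis dot_lmul_matrix inner_commute vector_transpose_matrix)
  then show ?thesis by simp
qed

section \<open>Isomorphic subspaces from injective linear maps\<close>

lemma isomorphic_subspacesI:
  assumes "linear f" "inj f" "subspace U" "f ` U = W"
  shows "isomorphic_subspaces U W"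
proof -
  have "subspace W"
    using linear_subspace_image[OF assms(1,3)] assms(4) by simp
  moreover have "bij_betw f U W"
    using assms(2,4) by (auto simp: bij_betw_def intro: inj_on_subset)
  ultimately show ?thesis
    using assms(1,3) by (auto simp: isomorphic_subspaces_def)
qed

section \<open>Motions and stresses as subspaces\<close>

lemma subspace_inf_motions: "subspace (inf_motions E p)"
  by (simp add: subspace_def inf_motions_def add_diff_add inner_add_right flip: scaleR_diff_right)

lemma subspace_skew_symmetric: "subspace {A. skew_symmetric A}"
proof -
  have "linear (\<lambda>A. A $ k $ l + A $ l $ k)" for k l :: 'a
    by (rule linearI) (simp_all add: algebra_simps)
  then have "subspace (\<Inter>k. \<Inter>l. {A :: real ^ 'a ^ 'a. A $ k $ l + A $ l $ k = 0})"
    by (auto intro!: subspace_Inter linear_subspace_kernel)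
  moreover have "{A :: real ^ 'a ^ 'a. skew_symmetric A} = (\<Inter>k. \<Inter>l. {A. A $ k $ l + A $ l $ k = 0})"
    by (auto simp: skew_symmetric_iff)
  ultimately show ?thesis
    by (simp only:)
qed

lemma subspace_trivial_motions: "subspace (trivial_motions E p)"
proof -
  let ?f = "\<lambda>(A, t). \<chi> i. A *v (p $ i) + t"
  have "linear ?f"
    by (rule linearI)
      (auto simp: vec_eq_iff matrix_vector_mult_def algebra_simps sum.distrib sum_distrib_left)
  then have "subspace (?f ` ({A. skew_symmetric A} \<times> UNIV))"
    by (intro linear_subspace_image subspace_Times subspace_skew_symmetric subspace_UNIV)
  moreover have "trivial_motions E p = inf_motions E p \<inter> ?f ` ({A. skew_symmetric A} \<times> UNIV)"
    by (auto simp: trivial_motions_def vec_eq_iff image_iff; blast)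
  ultimately show ?thesis
    by (simp only: subspace_inter[OF subspace_inf_motions])
qed

lemma subspace_symmetric_motions:
  assumes "\<And>x. x \<in> S \<Longrightarrow> linear x"
  shows "subspace (symmetric_motions S p)"
  by (simp add: subspace_def symmetric_motions_def linear_0[OF assms] linear_add[OF assms]
      linear_scale[OF assms])

lemma subspace_self_stresses:
  fixes E :: "'v::finite set set" and p :: "real ^ 'd ^ 'v"
  shows "subspace (self_stresses E p)"
proof -
  let ?F = "\<lambda>i \<omega>. \<Sum>j\<in>{j. {i, j} \<in> E}. (\<omega> $ {i, j}) *\<^sub>R (p $ i - p $ j)"
  have "linear (?F i)" for i
    by (rule linearI) (simp_all add: scaleR_add_left sum.distrib scaleR_sum_right)
  then have "subspace {\<omega>. ?F i \<omega> = 0}" for i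
    by (rule linear_subspace_kernel)
  moreover have "self_stresses E p = {\<omega>. \<forall>e. e \<notin> E \<longrightarrow> \<omega> $ e = 0} \<inter> (\<Inter>i. {\<omega>. ?F i \<omega> = 0})"
    by (auto simp: self_stresses_def)
  moreover have "subspace {\<omega> :: real ^ 'v set. \<forall>e. e \<notin> E \<longrightarrow> \<omega> $ e = 0}"
    by (simp add: subspace_def)
  ultimately show ?thesis
    by (simp only:) (intro subspace_inter subspace_Inter ballI; blast)
qed

lemma subspace_symmetric_stresses:
  fixes E :: "'v::finite set set" and p :: "real ^ 'd ^ 'v"
  shows "subspace (symmetric_stresses E S p)"
proof -
  let ?O = "edge_orbit S p"
  have const: "f constant_on F \<longleftrightarrow> (\<forall>x\<in>F. \<forall>y\<in>F. f x - f y = 0)" for f :: "'v set \<Rightarrow> real" and F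
    unfolding constant_on_def right_minus_eq by metis
  have "linear (\<lambda>\<omega> :: real ^ 'v set. \<omega> $ f - \<omega> $ g)" for f g
    by (rule linearI) (simp_all add: algebra_simps)
  then have "subspace (\<Inter>e\<in>E. \<Inter>f\<in>?O e. \<Inter>g\<in>?O e. {\<omega> :: real ^ 'v set. \<omega> $ f - \<omega> $ g = 0})"
    by (auto intro!: subspace_Inter linear_subspace_kernel simp del: right_minus_eq)
  moreover have "symmetric_stresses E S p = (\<Inter>e\<in>E. \<Inter>f\<in>?O e. \<Inter>g\<in>?O e. {\<omega>. \<omega> $ f - \<omega> $ g = 0})"
    unfolding symmetric_stresses_def const by blast
  ultimately show ?thesis
    by (simp only:)
qed

text \<open>
  Since a stress vanishes off the edge set, the equilibrium condition at a vertex may be summed over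
  all vertices.
\<close>

lemma self_stresses_iff:
  "\<omega> \<in> self_stresses E p \<longleftrightarrow>
     (\<forall>e. e \<notin> E \<longrightarrow> \<omega> $ e = 0) \<and> (\<forall>i. (\<Sum>j\<in>UNIV. (\<omega> $ {i, j}) *\<^sub>R (p $ i - p $ j)) = 0)"
proof -
  have "(\<Sum>j\<in>{j. {i, j} \<in> E}. (\<omega> $ {i, j}) *\<^sub>R (p $ i - p $ j)) =
      (\<Sum>j\<in>UNIV. (\<omega> $ {i, j}) *\<^sub>R (p $ i - p $ j))" if "\<forall>e. e \<notin> E \<longrightarrow> \<omega> $ e = 0" for i
    using that by (intro sum.mono_neutral_left) auto
  then show ?thesis
    by (auto simp: self_stresses_def)
qed

section \<open>The cone over a graph\<close>

lemma cone_graph_edge [simp]: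
  "{None, Some i} \<in> cone_graph E" "{Some i, None} \<in> cone_graph E"
  "{None} \<notin> cone_graph E"
  by (auto simp: cone_graph_def insert_commute)

lemma image_Some_in_cone_graph [simp]: "Some ` e \<in> cone_graph E \<longleftrightarrow> e \<in> E"
  by (auto simp: cone_graph_def inj_image_eq_iff)

lemma Some_Some_in_cone_graph [simp]: "{Some i, Some j} \<in> cone_graph E \<longleftrightarrow> {i, j} \<in> E"
  using image_Some_in_cone_graph[of "{i, j}" E] by simp

lemma ball_cone_graph:
  "(\<forall>e\<in>cone_graph E. P e) \<longleftrightarrow> (\<forall>e\<in>E. P (Some ` e)) \<and> (\<forall>i. P {None, Some i})"
  unfolding cone_graph_def by blast

lemma cone_conf_nth [simp]: "cone_conf q $ None = 0" "cone_conf q $ Some i = q $ i"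
  by (simp_all add: cone_conf_def)

text \<open>The edges at the cone vertex force the motion to be tangent to the sphere.\<close>

lemma sphere_motions_iff:
  "v \<in> sphere_motions E q \<longleftrightarrow> v $ None = 0 \<and> (\<forall>i. q $ i \<bullet> v $ Some i = 0) \<and>
     (\<forall>i j. {i, j} \<in> E \<longrightarrow> (q $ i - q $ j) \<bullet> (v $ Some i - v $ Some j) = 0)"
  by (auto simp: sphere_motions_def inf_motions_def split_option_all inner_commute)

text \<open>
  An arbitrary set of cone vertices is considered here, because stresses are indexed by all vertex
  sets.
\<close>

lemma cone_edge_cases:
  fixes E :: "'v::finite set set" and e :: "'v option set"
  obtains e' where "e = Some ` e'" | i where "e = {None, Some i}"
    | "None \<in> e" "e \<notin> cone_graph E"
proof (cases "None \<in> e")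
  case True
  moreover have "(\<exists>e'. e = Some ` e') \<or> (\<exists>i. e = {None, Some i})" if "e \<in> cone_graph E"
    using that unfolding cone_graph_def by blast
  ultimately show ?thesis
    using that by metis
next
  case False
  then have "e = Some ` (Some -` e)"
    by (auto simp: image_iff) (metis not_None_eq)
  with that show ?thesis
    by blast
qed

text \<open>
  The stress terms at an edge seen from its two ends are opposite, so the sum of all equilibrium
  conditions vanishes identically; equilibrium at the cone vertex is therefore a consequence of
  equilibrium at all other vertices.
\<close>

lemma cone_vertex_equilibrium:
  fixes \<omega> :: "real ^ 'w::finite option set" and r :: "real ^ 'e ^ 'w option"
  assumes "\<And>i. (\<Sum>j\<in>UNIV. (\<omega> $ {Some i, j}) *\<^sub>R (r $ Some i - r $ j)) = 0"
  shows "(\<Sum>j\<in>UNIV. (\<omega> $ {None, j}) *\<^sub>R (r $ None - r $ j)) = 0"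
proof -
  let ?f = "\<lambda>i j. (\<omega> $ {i, j}) *\<^sub>R (r $ i - r $ j)"
  have "(\<Sum>i\<in>UNIV. \<Sum>j\<in>UNIV. ?f i j) = (\<Sum>i\<in>UNIV. \<Sum>j\<in>UNIV. ?f j i)"
    by (rule sum.swap)
  also have "\<dots> = (\<Sum>i\<in>UNIV. \<Sum>j\<in>UNIV. - ?f i j)"
    by (simp add: insert_commute algebra_simps)
  also have "\<dots> = - (\<Sum>i\<in>UNIV. \<Sum>j\<in>UNIV. ?f i j)"
    by (simp only: sum_negf)
  finally have "(\<Sum>i\<in>UNIV. \<Sum>j\<in>UNIV. ?f i j) = 0"
    by (simp add: eq_neg_iff_add_eq_0 flip: scaleR_2)
  then show ?thesis
    using assms by (subst (asm) sum_UNIV_option) simp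
qed

section \<open>Central projection of a symmetric framework\<close>

text \<open>
  A framework \<open>p\<close> with symmetry group \<open>S\<close>, and its central projection \<open>q\<close> to the upper hemisphere. The
  graph automorphism belonging to \<open>x \<in> S\<close> is \<open>vertex_action p x\<close>. The height \<open>h i\<close> is the norm of
  \<open>(p i, 1)\<close>, so that \<open>1 / h i\<close> is the last coordinate of \<open>q i\<close>.
\<close>

locale projected_framework =
  fixes S :: "(real ^ 'd \<Rightarrow> real ^ 'd) set"
    and E :: "'v::finite set set"
    and p :: "real ^ 'd ^ 'v"
    and q :: "real ^ 'd option ^ 'v"
    and h :: "'v \<Rightarrow> real"
  assumes orthogonal: "x \<in> S \<Longrightarrow> orthogonal_transformation x"
    and id_in_S: "id \<in> S"
    and inj_p: "inj (\<lambda>i. p $ i)"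
    and action_aut: "x \<in> S \<Longrightarrow> vertex_action p x \<in> graph_aut E"
    and action: "x \<in> S \<Longrightarrow> x (p $ i) = p $ vertex_action p x i"
    and h_eq: "h i = norm (homogenize (p $ i))"
    and q_eq: "q $ i = (1 / h i) *\<^sub>R homogenize (p $ i)"
begin

lemma h_pos [simp]: "h i > 0"
  by (simp add: h_eq homogenize_eq append_coord_eq_0_iff)

lemma h_nonzero [simp]: "h i \<noteq> 0"
  using h_pos[of i] by linarith

lemma linear_S: "x \<in> S \<Longrightarrow> linear x"
  using orthogonal orthogonal_transformation_linear by blast

text \<open>Symmetries preserve the distance to the origin, and thus the height.\<close>

lemma h_action [simp]:
  assumes "x \<in> S"
  shows "h (vertex_action p x i) = h i"
proof -
  have "norm (p $ vertex_action p x i) = norm (p $ i)"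
    using action[OF assms] orthogonal[OF assms] by (metis orthogonal_transformation)
  then show ?thesis
    by (simp add: h_eq homogenize_eq norm_eq_sqrt_inner)
qed

lemma inj_q: "inj (\<lambda>i. q $ i)"
proof (rule injI)
  fix i j
  assume "q $ i = q $ j"
  then have eq: "append_coord ((1 / h i) *\<^sub>R p $ i) (1 / h i) = append_coord ((1 / h j) *\<^sub>R p $ j) (1 / h j)"
    unfolding q_eq homogenize_eq append_coord_algebra mult_1_right .
  then have hij: "h i = h j"
    by simp
  have "p $ i = p $ j"
    using eq by (simp add: hij)
  with inj_p show "i = j"
    by (simp add: inj_eq)
qed

lemma inj_cone_conf: "inj (\<lambda>i. cone_conf q $ i)"
proof (rule injI)
  fix i j
  assume "cone_conf q $ i = cone_conf q $ j"
  moreover have "q $ k \<noteq> 0" for k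
    by (simp add: q_eq homogenize_eq append_coord_eq_0_iff)
  then have "q $ k \<noteq> 0" "0 \<noteq> q $ k" for k
    by metis+
  ultimately show "i = j"
    using inj_q by (cases i; cases j) (auto simp: inj_eq)
qed

lemma star_q:
  assumes "x \<in> S"
  shows "star x (q $ i) = q $ vertex_action p x i"
  using assms
  by (simp add: q_eq homogenize_eq append_coord_algebra star_append_coord linear_S
      action[OF assms] linear_scale[OF linear_S[OF assms]])

text \<open>
  The symmetry \<open>star x\<close> fixes the cone vertex and permutes the other vertices of the cone in the
  way in which \<open>x\<close> permutes the vertices of the graph.
\<close>

lemma cone_action:
  assumes "x \<in> S"
  shows "vertex_action (cone_conf q) (star x) = map_option (vertex_action p x)"
proof
  fix i
  have "star x (cone_conf q $ i) = cone_conf q $ map_option (vertex_action p x) i"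
    by (cases i) (simp_all add: star_q[OF assms])
  then show "vertex_action (cone_conf q) (star x) i = map_option (vertex_action p x) i"
    by (rule vertex_action_eq[OF inj_cone_conf])
qed

lemma action_id: "vertex_action p id i = i"
  by (rule vertex_action_eq[OF inj_p]) simp

lemma action_bij: "x \<in> S \<Longrightarrow> bij (vertex_action p x)"
  using action_aut[of x] unfolding graph_aut_def by blast

lemma action_edge: "x \<in> S \<Longrightarrow> {vertex_action p x i, vertex_action p x j} \<in> E \<longleftrightarrow> {i, j} \<in> E"
  using action_aut[of x] unfolding graph_aut_def by blast

subsection \<open>Infinitesimal motions\<close>

text \<open>
  The motion of the cone, fixing the cone vertex, that corresponds to a motion of \<open>p\<close>: its value at \<open>i\<close>
  is a multiple of \<open>(u i, c)\<close> with \<open>c\<close> chosen to make it orthogonal to \<open>(p i, 1)\<close>.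
\<close>

definition lift_motion :: "real ^ 'd ^ 'v \<Rightarrow> real ^ 'd option ^ 'v option" where
  "lift_motion u = (\<chi> i. case i of None \<Rightarrow> 0
     | Some i \<Rightarrow> (1 / h i) *\<^sub>R append_coord (u $ i) (- (u $ i \<bullet> p $ i)))"

lemma lift_motion_nth [simp]:
  "lift_motion u $ None = 0"
  "lift_motion u $ Some i = (1 / h i) *\<^sub>R append_coord (u $ i) (- (u $ i \<bullet> p $ i))"
  by (simp_all add: lift_motion_def)

lemma linear_lift_motion: "linear lift_motion"
  by (rule linearI)
    (auto simp: vec_eq_iff lift_motion_def append_coord_def algebra_simps
      add_divide_distrib diff_divide_distrib split: option.splits)

lemma inj_lift_motion: "inj lift_motion"
proof (rule injI)
  fix u v
  assume "lift_motion u = lift_motion v"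
  then have "lift_motion u $ Some i = lift_motion v $ Some i" for i
    by simp
  then show "u = v"
    by (simp add: vec_eq_iff[of u])
qed

lemma lift_motion_in_sphere_motions:
  "lift_motion u \<in> sphere_motions E q \<longleftrightarrow> u \<in> inf_motions E p"
proof -
  have tangent: "q $ i \<bullet> lift_motion u $ Some i = 0" for i
    by (simp add: q_eq homogenize_eq inner_commute)
  have "(q $ i - q $ j) \<bullet> (lift_motion u $ Some i - lift_motion u $ Some j) =
      (1 / (h i * h j)) * ((p $ i - p $ j) \<bullet> (u $ i - u $ j))" for i j
  proof -
    \<comment> \<open>Tangency leaves only the mixed terms.\<close>
    have "(q $ i - q $ j) \<bullet> (lift_motion u $ Some i - lift_motion u $ Some j) =
        - (q $ i \<bullet> lift_motion u $ Some j) - q $ j \<bullet> lift_motion u $ Some i"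
      using tangent by (simp add: inner_diff_left inner_diff_right del: lift_motion_nth)
    also have "\<dots> = (1 / (h i * h j)) * ((p $ i - p $ j) \<bullet> (u $ i - u $ j))"
      by (simp add: q_eq homogenize_eq inner_diff_left inner_diff_right inner_commute field_simps)
    finally show ?thesis .
  qed
  then show ?thesis
    using tangent by (simp add: sphere_motions_iff inf_motions_def del: lift_motion_nth(2))
qed

lemma sphere_motions_subset_range: "sphere_motions E q \<subseteq> range lift_motion"
proof
  fix v
  assume v: "v \<in> sphere_motions E q"
  define u where "u = (\<chi> i. h i *\<^sub>R (\<chi> l. v $ Some i $ Some l))"
  have "v $ Some i = lift_motion u $ Some i" for i
  proof -
    obtain a c where ac: "v $ Some i = append_coord a c"
      by (rule append_coord_cases)
    have "q $ i \<bullet> v $ Some i = 0"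
      using v by (simp add: sphere_motions_iff)
    then have "c = - (a \<bullet> p $ i)"
      by (simp add: ac q_eq homogenize_eq inner_commute)
    moreover have "u $ i = h i *\<^sub>R a"
      by (simp add: u_def ac vec_eq_iff)
    ultimately show ?thesis
      by (simp add: ac append_coord_algebra)
  qed
  moreover have "v $ None = 0"
    using v by (simp add: sphere_motions_iff)
  ultimately have "v = lift_motion u"
    by (simp add: vec_eq_iff[of v] split_option_all)
  then show "v \<in> range lift_motion"
    by blast
qed

lemma skew_extension_q:
  assumes "skew_symmetric A"
  shows "skew_extension A t *v (q $ i) = (1 / h i) *\<^sub>R
    append_coord (A *v (p $ i) + t) (- ((A *v (p $ i) + t) \<bullet> p $ i))"
  by (simp add: q_eq homogenize_eq matrix_vector_mult_scaleR skew_extension_mult inner_add_left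
      skew_symmetric_inner_self[OF assms])

lemma lift_motion_in_sphere_trivial_motions:
  "lift_motion u \<in> sphere_trivial_motions E q \<longleftrightarrow> u \<in> trivial_motions E p"
proof -
  have "(\<exists>B. skew_symmetric B \<and> (\<forall>i. lift_motion u $ Some i = B *v (q $ i))) \<longleftrightarrow>
      (\<exists>A t. skew_symmetric A \<and> (\<forall>i. u $ i = A *v (p $ i) + t))" (is "?L \<longleftrightarrow> ?R")
  proof
    assume ?L
    then obtain B where B: "skew_symmetric B" "\<And>i. lift_motion u $ Some i = B *v (q $ i)"
      by blast
    obtain A t where A: "skew_symmetric A" "B = skew_extension A t"
      using B(1) by (rule skew_symmetric_extensionE)
    have "u $ i = A *v (p $ i) + t" for i
      using B(2)[of i] by (simp add: A(2) skew_extension_q[OF A(1)])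
    with A(1) show ?R
      by blast
  next
    assume ?R
    then obtain A t where A: "skew_symmetric A" "\<And>i. u $ i = A *v (p $ i) + t"
      by blast
    then have "lift_motion u $ Some i = skew_extension A t *v (q $ i)" for i
      by (simp add: skew_extension_q)
    then show ?L
      using skew_symmetric_extension[OF A(1)] by blast
  qed
  then show ?thesis
    by (simp add: sphere_trivial_motions_def trivial_motions_def lift_motion_in_sphere_motions
        del: lift_motion_nth)
qed

lemma lift_motion_in_symmetric_motions:
  "lift_motion u \<in> symmetric_motions (star ` S) (cone_conf q) \<longleftrightarrow> u \<in> symmetric_motions S p"
proof -
  have "star x (lift_motion u $ Some i) = lift_motion u $ Some (vertex_action p x i) \<longleftrightarrow>
      x (u $ i) = u $ vertex_action p x i" if "x \<in> S" for x i
  proof -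
    have "u $ i \<bullet> p $ i = x (u $ i) \<bullet> p $ vertex_action p x i"
      using orthogonal[OF that] by (simp add: orthogonal_transformation_def flip: action[OF that])
    then show ?thesis
      using linear_S[OF that]
      by (auto simp: append_coord_algebra star_append_coord h_action[OF that] linear_scale[OF linear_S[OF that]])
  qed
  then show ?thesis
    by (simp add: symmetric_motions_def split_option_all cone_action del: lift_motion_nth(2))
qed

subsection \<open>Self-stresses\<close>

text \<open>
  The stress of the cone that corresponds to a stress of \<open>p\<close>. It has to be defined, linearly in \<open>\<omega>\<close>, on
  all vertex sets: the product gives \<open>\<omega> i j * h i * h j\<close> at an edge of the graph; the outer sum has the
  single summand \<open>i\<close> at the cone edge \<open>{None, Some i}\<close>, and it is empty at every other set that contains
  \<open>None\<close>. In the inner sum all vertices \<open>j\<close> are admitted, since a stress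
  vanishes off the edge set.
\<close>

definition lift_stress :: "real ^ 'v set \<Rightarrow> real ^ 'v option set" where
  "lift_stress \<omega> = (\<chi> e.
     if None \<in> e then \<Sum>i | e = {None, Some i}. h i * (\<Sum>j\<in>UNIV. \<omega> $ {i, j} * (h i - h j))
     else \<omega> $ (Some -` e) * (\<Prod>i\<in>Some -` e. h i))"

lemma lift_stress_image_Some [simp]: "lift_stress \<omega> $ (Some ` e) = \<omega> $ e * (\<Prod>i\<in>e. h i)"
proof -
  have "Some -` Some ` e = e"
    by (simp add: inj_vimage_image_eq)
  then show ?thesis
    by (auto simp: lift_stress_def)
qed

lemma lift_stress_edge:
  assumes "i \<noteq> j"
  shows "lift_stress \<omega> $ {Some i, Some j} = \<omega> $ {i, j} * (h i * h j)"
  using lift_stress_image_Some[of \<omega> "{i, j}"] assms by simp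

lemma lift_stress_cone_edge:
  "lift_stress \<omega> $ {None, Some i} = h i * (\<Sum>j\<in>UNIV. \<omega> $ {i, j} * (h i - h j))"
proof -
  have "{k. {None, Some i} = {None, Some k}} = {i}"
    by (auto simp: doubleton_eq_iff)
  then show ?thesis
    by (simp add: lift_stress_def)
qed

lemma lift_stress_other:
  assumes "None \<in> e" "e \<notin> cone_graph E"
  shows "lift_stress \<omega> $ e = 0"
proof -
  have "{i. e = {None, Some i}} = {}"
    using assms(2) by auto
  then show ?thesis
    using assms(1) by (simp add: lift_stress_def)
qed

lemma linear_lift_stress: "linear lift_stress"
  by (rule linearI)
    (auto simp: vec_eq_iff lift_stress_def algebra_simps sum.distrib sum_distrib_left
      sum_subtractf)

lemma inj_lift_stress: "inj lift_stress"
proof (rule injI)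
  fix \<omega> \<omega>'
  assume "lift_stress \<omega> = lift_stress \<omega>'"
  then have "lift_stress \<omega> $ (Some ` e) = lift_stress \<omega>' $ (Some ` e)" for e
    by simp
  then show "\<omega> = \<omega>'"
    by (simp add: vec_eq_iff[of \<omega>])
qed

text \<open>
  The resultants of the two stresses at a vertex are proportional. The identity holds for every \<open>\<omega>\<close>
  and so yields both directions of the correspondence of equilibrium stresses.
\<close>

lemma lift_stress_equilibrium:
  "(\<Sum>j\<in>UNIV. (lift_stress \<omega> $ {Some i, j}) *\<^sub>R (cone_conf q $ Some i - cone_conf q $ j)) =
     h i *\<^sub>R append_coord (\<Sum>j\<in>UNIV. (\<omega> $ {i, j}) *\<^sub>R (p $ i - p $ j)) 0"
proof -
  let ?P = "\<lambda>i. homogenize (p $ i)"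
  have edge: "(lift_stress \<omega> $ {Some i, Some j}) *\<^sub>R (q $ i - q $ j) =
      (\<omega> $ {i, j}) *\<^sub>R (h j *\<^sub>R ?P i - h i *\<^sub>R ?P j)" for j
    \<comment> \<open>For \<open>i = j\<close> the vertex set is a singleton, but both sides vanish.\<close>
    by (cases "i = j") (auto simp: lift_stress_edge q_eq algebra_simps)
  have "(\<Sum>j\<in>UNIV. (lift_stress \<omega> $ {Some i, j}) *\<^sub>R (cone_conf q $ Some i - cone_conf q $ j)) =
      (lift_stress \<omega> $ {None, Some i}) *\<^sub>R q $ i +
      (\<Sum>j\<in>UNIV. (\<omega> $ {i, j}) *\<^sub>R (h j *\<^sub>R ?P i - h i *\<^sub>R ?P j))"
    by (simp add: sum_UNIV_option edge insert_commute[of "Some i" None])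
  also have "\<dots> = (\<Sum>j\<in>UNIV. (\<omega> $ {i, j} * (h i - h j)) *\<^sub>R ?P i +
      (\<omega> $ {i, j}) *\<^sub>R (h j *\<^sub>R ?P i - h i *\<^sub>R ?P j))"
    by (simp add: lift_stress_cone_edge q_eq sum.distrib scaleR_sum_left)
  also have "\<dots> = (\<Sum>j\<in>UNIV. h i *\<^sub>R (\<omega> $ {i, j}) *\<^sub>R (?P i - ?P j))"
    by (intro sum.cong) (auto simp: algebra_simps)
  also have "\<dots> = h i *\<^sub>R append_coord (\<Sum>j\<in>UNIV. (\<omega> $ {i, j}) *\<^sub>R (p $ i - p $ j)) 0"
    by (simp add: homogenize_eq append_coord_algebra sum_append_coord scaleR_sum_right)
  finally show ?thesis .
qed

lemma lift_stress_in_self_stresses: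
  "lift_stress \<omega> \<in> self_stresses (cone_graph E) (cone_conf q) \<longleftrightarrow> \<omega> \<in> self_stresses E p"
proof -
  have support: "(\<forall>e. e \<notin> cone_graph E \<longrightarrow> lift_stress \<omega> $ e = 0) \<longleftrightarrow> (\<forall>e. e \<notin> E \<longrightarrow> \<omega> $ e = 0)"
    (is "?L \<longleftrightarrow> ?R")
  proof
    assume ?L
    then have "e \<notin> E \<Longrightarrow> lift_stress \<omega> $ (Some ` e) = 0" for e
      by (metis image_Some_in_cone_graph)
    then show ?R
      by simp
  next
    assume R: ?R
    show ?L
    proof (intro allI impI)
      fix e
      assume "e \<notin> cone_graph E"
      then show "lift_stress \<omega> $ e = 0"
        using R by (cases e rule: cone_edge_cases[where E = E]) (auto simp: lift_stress_other)
    qed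
  qed
  let ?eq = "\<lambda>i. (\<Sum>j\<in>UNIV. (lift_stress \<omega> $ {i, j}) *\<^sub>R (cone_conf q $ i - cone_conf q $ j)) = 0"
  have "(\<forall>i. ?eq i) \<longleftrightarrow> (\<forall>i. ?eq (Some i))"
    unfolding split_option_all[of ?eq] using cone_vertex_equilibrium by blast
  also have "\<dots> \<longleftrightarrow> (\<forall>i. (\<Sum>j\<in>UNIV. (\<omega> $ {i, j}) *\<^sub>R (p $ i - p $ j)) = 0)"
    by (simp only: lift_stress_equilibrium) (simp add: append_coord_eq_0_iff)
  finally show ?thesis
    by (simp only: self_stresses_iff support)
qed

lemma self_stresses_subset_range:
  "self_stresses (cone_graph E) (cone_conf q) \<subseteq> range lift_stress"
proof
  fix \<omega>
  assume \<omega>: "\<omega> \<in> self_stresses (cone_graph E) (cone_conf q)"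
  define \<psi> where "\<psi> = (\<chi> e. \<omega> $ (Some ` e) / (\<Prod>i\<in>e. h i))"
  have "\<omega> $ e = lift_stress \<psi> $ e" for e
  proof (cases e rule: cone_edge_cases[where E = E])
    case (1 e')
    then show ?thesis
      by (simp add: \<psi>_def)
  next
    case (2 i)
    have "(\<Sum>j\<in>UNIV. (\<omega> $ {Some i, j}) *\<^sub>R (cone_conf q $ Some i - cone_conf q $ j)) = 0"
      using \<omega> unfolding self_stresses_iff by blast
    \<comment> \<open>The last coordinate of the equilibrium at \<open>i\<close> determines the stress on the cone edge.\<close>
    then have "(\<Sum>j\<in>UNIV. (\<omega> $ {Some i, j}) *\<^sub>R (cone_conf q $ Some i - cone_conf q $ j)) $ None = 0"
      by (simp only: zero_index)
    then have "\<omega> $ {None, Some i} / h i +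
        (\<Sum>j\<in>UNIV. \<omega> $ {Some i, Some j} * (1 / h i - 1 / h j)) = 0"
      by (simp add: sum_UNIV_option q_eq homogenize_eq insert_commute[of "Some i" None])
    moreover have "\<omega> $ {Some i, Some j} * (1 / h i - 1 / h j) = - (\<psi> $ {i, j} * (h i - h j))" for j
      by (cases "i = j") (auto simp: \<psi>_def field_simps)
    ultimately have "\<omega> $ {None, Some i} / h i = (\<Sum>j\<in>UNIV. \<psi> $ {i, j} * (h i - h j))"
      by (simp add: sum_negf)
    then show ?thesis
      by (simp add: 2 lift_stress_cone_edge field_simps)
  next
    case 3
    then show ?thesis
      using \<omega> by (simp add: lift_stress_other self_stresses_iff)
  qed
  then have "\<omega> = lift_stress \<psi>"
    by (simp add: vec_eq_iff)
  then show "\<omega> \<in> range lift_stress"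
    by blast
qed

text \<open>The identity lies in \<open>S\<close>, so every edge belongs to its own orbit.\<close>

lemma symmetric_stresses_iff:
  "\<omega> \<in> symmetric_stresses E S p \<longleftrightarrow> (\<forall>e\<in>E. \<forall>x\<in>S. \<omega> $ (vertex_action p x ` e) = \<omega> $ e)"
proof -
  have "(\<lambda>f. \<omega> $ f) constant_on edge_orbit S p e \<longleftrightarrow>
      (\<forall>x\<in>S. \<omega> $ (vertex_action p x ` e) = \<omega> $ e)" for e
    using id_in_S action_id by (force simp: constant_on_def edge_orbit_def)
  then show ?thesis
    by (simp add: symmetric_stresses_def)
qed

lemma cone_symmetric_stresses_iff:
  "\<omega> \<in> symmetric_stresses (cone_graph E) (star ` S) (cone_conf q) \<longleftrightarrow>
     (\<forall>e\<in>E. \<forall>x\<in>S. \<omega> $ (Some ` vertex_action p x ` e) = \<omega> $ (Some ` e)) \<and>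
     (\<forall>i. \<forall>x\<in>S. \<omega> $ {None, Some (vertex_action p x i)} = \<omega> $ {None, Some i})"
proof -
  have orbit: "edge_orbit (star ` S) (cone_conf q) e = (\<lambda>x. map_option (vertex_action p x) ` e) ` S" for e
    by (auto simp: edge_orbit_def cone_action image_image)
  have "map_option (vertex_action p id) = id"
    using action_id by (simp add: option.map_ident_strong fun_eq_iff)
  then have "(\<lambda>f. \<omega> $ f) constant_on edge_orbit (star ` S) (cone_conf q) e \<longleftrightarrow>
      (\<forall>x\<in>S. \<omega> $ (map_option (vertex_action p x) ` e) = \<omega> $ e)" for e
    using id_in_S by (force simp: constant_on_def orbit)
  then show ?thesis
    by (simp add: symmetric_stresses_def ball_cone_graph image_image)
qed

text \<open>
  The value at a cone edge is invariant because the sum that defines it may be reindexed by the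
  automorphism; pairs that are not edges contribute nothing, which needs \<open>\<omega>\<close> to vanish there.
\<close>

lemma lift_stress_in_symmetric_stresses:
  assumes \<omega>: "\<omega> \<in> self_stresses E p"
  shows "lift_stress \<omega> \<in> symmetric_stresses (cone_graph E) (star ` S) (cone_conf q) \<longleftrightarrow>
    \<omega> \<in> symmetric_stresses E S p"
proof -
  have prod: "(\<Prod>i\<in>vertex_action p x ` e. h i) = (\<Prod>i\<in>e. h i)" if "x \<in> S" for x e
    using that action_bij[OF that]
    by (subst prod.reindex) (auto simp: bij_def intro: inj_on_subset)
  then have edges: "lift_stress \<omega> $ (Some ` vertex_action p x ` e) = lift_stress \<omega> $ (Some ` e) \<longleftrightarrow>
      \<omega> $ (vertex_action p x ` e) = \<omega> $ e" if "x \<in> S" for x e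
    using that by simp
  have cone_edges: "lift_stress \<omega> $ {None, Some (vertex_action p x i)} = lift_stress \<omega> $ {None, Some i}"
    if sym: "\<omega> \<in> symmetric_stresses E S p" and x: "x \<in> S" for x i
  proof -
    let ?\<sigma> = "vertex_action p x"
    have inv: "\<omega> $ {?\<sigma> i, ?\<sigma> j} = \<omega> $ {i, j}" for j
    proof (cases "{i, j} \<in> E")
      case True
      then have "\<omega> $ (?\<sigma> ` {i, j}) = \<omega> $ {i, j}"
        using sym x by (simp only: symmetric_stresses_iff)
      then show ?thesis
        by simp
    next
      case False
      then show ?thesis
        using \<omega> action_edge[OF x] by (simp add: self_stresses_iff)
    qed
    have "(\<Sum>j\<in>UNIV. \<omega> $ {?\<sigma> i, j} * (h i - h j)) = (\<Sum>j\<in>UNIV. \<omega> $ {?\<sigma> i, ?\<sigma> j} * (h i - h (?\<sigma> j)))"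
      using sum.reindex_bij_betw[OF action_bij[OF x], of "\<lambda>j. \<omega> $ {?\<sigma> i, j} * (h i - h j)"] by simp
    then show ?thesis
      using x by (simp add: lift_stress_cone_edge inv)
  qed
  show ?thesis
    using edges cone_edges
    by (auto simp: cone_symmetric_stresses_iff symmetric_stresses_iff)
qed

subsection \<open>The isomorphisms\<close>

lemma lift_motion_image:
  "lift_motion ` (inf_motions E p \<inter> symmetric_motions S p) =
     sphere_motions E q \<inter> symmetric_motions (star ` S) (cone_conf q)"
  using sphere_motions_subset_range lift_motion_in_sphere_motions lift_motion_in_symmetric_motions
  by blast

lemma lift_motion_image_trivial:
  "lift_motion ` (trivial_motions E p \<inter> symmetric_motions S p) =
     sphere_trivial_motions E q \<inter> symmetric_motions (star ` S) (cone_conf q)"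
proof -
  have "sphere_trivial_motions E q \<subseteq> range lift_motion"
    using sphere_motions_subset_range by (auto simp: sphere_trivial_motions_def)
  then show ?thesis
    using lift_motion_in_sphere_trivial_motions lift_motion_in_symmetric_motions by blast
qed

lemma lift_stress_image:
  "lift_stress ` (self_stresses E p \<inter> symmetric_stresses E S p) =
     self_stresses (cone_graph E) (cone_conf q) \<inter>
     symmetric_stresses (cone_graph E) (star ` S) (cone_conf q)"
  using self_stresses_subset_range lift_stress_in_self_stresses lift_stress_in_symmetric_stresses
  by blast

lemma nontrivial_iff:
  "(\<exists>u. u \<in> inf_motions E p \<inter> symmetric_motions S p \<and> u \<notin> trivial_motions E p) \<longleftrightarrow>
   (\<exists>u. u \<in> sphere_motions E q \<inter> symmetric_motions (star ` S) (cone_conf q) \<and>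
        u \<notin> sphere_trivial_motions E q)"
  using lift_motion_in_sphere_trivial_motions by (auto simp flip: lift_motion_image)

end

lemma projects_to_upper_hemisphere:
  assumes "q $ i \<in> upper_hemisphere" "projects_to q p"
  shows "q $ i = (1 / norm (homogenize (p $ i))) *\<^sub>R homogenize (p $ i)"
proof -
  obtain \<alpha> where \<alpha>: "q $ i = \<alpha> *\<^sub>R homogenize (p $ i)"
    using assms(2) by (auto simp: projects_to_def)
  have "\<alpha> > 0" and "norm (q $ i) = 1"
    using assms(1) by (auto simp: upper_hemisphere_def \<alpha> homogenize_eq)
  then have "\<alpha> * norm (homogenize (p $ i)) = 1"
    by (simp add: \<alpha>)
  then show ?thesis
    by (metis \<alpha> mult_zero_right nonzero_eq_divide_eq zero_neq_one)
qed

theorem theorem3p7: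
  fixes S :: "(real ^ 'd \<Rightarrow> real ^ 'd) set"
    and E :: "'v::finite set set"
    and p :: "real ^ 'd ^ 'v"
    and q :: "real ^ 'd option ^ 'v"
  assumes "symmetry_group S"
    and "p \<in> symmetric_frameworks E S"
    and "\<forall>i. q $ i \<in> upper_hemisphere"
    and "cone_conf q \<in> symmetric_frameworks (cone_graph E) (star ` S)"
    and "projects_to q p"
  shows
    "isomorphic_subspaces
       (inf_motions E p \<inter> symmetric_motions S p)
       (sphere_motions E q \<inter> symmetric_motions (star ` S) (cone_conf q)) \<and>
     isomorphic_subspaces
       (trivial_motions E p \<inter> symmetric_motions S p)
       (sphere_trivial_motions E q \<inter> symmetric_motions (star ` S) (cone_conf q)) \<and>
     ((\<exists>u. u \<in> inf_motions E p \<inter> symmetric_motions S p \<and> u \<notin> trivial_motions E p) \<longleftrightarrow>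
      (\<exists>u. u \<in> sphere_motions E q \<inter> symmetric_motions (star ` S) (cone_conf q) \<and>
           u \<notin> sphere_trivial_motions E q)) \<and>
     isomorphic_subspaces
       (self_stresses E p \<inter> symmetric_stresses E S p)
       (self_stresses (cone_graph E) (cone_conf q) \<inter>
        symmetric_stresses (cone_graph E) (star ` S) (cone_conf q))"
proof -
  have sub: "subgroup S orthogonal_group"
    using assms(1) by (simp add: symmetry_group_def)
  obtain \<Phi> where fw: "framework E p"
    and \<Phi>: "\<And>x. x \<in> S \<Longrightarrow> \<Phi> x \<in> graph_aut E" "\<And>x i. x \<in> S \<Longrightarrow> x (p $ i) = p $ \<Phi> x i"
    using assms(2) by (auto simp: symmetric_frameworks_def)
  have inj: "inj (\<lambda>i. p $ i)"
    using fw by (auto simp: framework_def)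
  have act: "vertex_action p x = \<Phi> x" if "x \<in> S" for x
    using vertex_action_eq[OF inj] \<Phi>(2)[OF that] by (simp add: fun_eq_iff)
  interpret projected_framework S E p q "\<lambda>i. norm (homogenize (p $ i))"
  proof
    show "orthogonal_transformation x" if "x \<in> S" for x
      using subgroup.subset[OF sub] that by (auto simp: orthogonal_group_def)
    show "id \<in> S"
      using subgroup.one_closed[OF sub] by (simp add: orthogonal_group_def)
    show "q $ i = (1 / norm (homogenize (p $ i))) *\<^sub>R homogenize (p $ i)" for i
      using assms(3,5) projects_to_upper_hemisphere by blast
  qed (use inj act \<Phi> in auto)
  have "subspace (symmetric_motions S p)"
    by (rule subspace_symmetric_motions) (rule linear_S)
  then show ?thesis
    using nontrivial_iff
    by (intro conjI isomorphic_subspacesI[OF linear_lift_motion inj_lift_motion]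
        isomorphic_subspacesI[OF linear_lift_stress inj_lift_stress] subspace_inter
        subspace_inf_motions subspace_trivial_motions subspace_self_stresses
        subspace_symmetric_stresses lift_motion_image lift_motion_image_trivial lift_stress_image)
qed

end
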